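(* A function $f\colon\mathbb Z\to\mathbb Z$ is $+$-congruence preserving if and only if for every $\langle\mathbb Z;+\rangle$-recognizable subset $L$ of $\mathbb Z$ the lattice $\mathfrak L_{\langle\mathbb Z;+\rangle}(L)$ is closed under $f^{-1}$.
   Context: A $+$-congruence is an equivalence relation $\sim$ on $\mathbb Z$ such that $x\sim y$ and $x'\sim y'$ imply $x+x'\sim y+y'$. $f$ is $+$-congruence preserving if for every $+$-congruence $\sim$, $x\sim y$ implies $f(x)\sim f(y)$. $L\subseteq\mathbb Z$ is $\langle\mathbb Z;+\rangle$-recognizable if there are a finite algebra $\langle M;\oplus\rangle$ with one binary operation and a surjective morphism $\varphi\colon\langle\mathbb Z;+\rangle\to\langle M;\oplus\rangle$ with $L=\varphi^{-1}(\varphi(L))$. A lattice of subsets of $\mathbb Z$ means a bounded one: a family of subsets containing $\mathbb Z$ and $\emptyset$ and closed under binary unions and intersections. $\mathfrak L_{\langle\mathbb Z;+\rangle}(L)$ is the smallest lattice of subsets of $\mathbb Z$ which contains $L$ and is closed under $X\mapsto\{x\mid x+a\in X\}$ for all $a\in\mathbb Z$. A lattice $\mathfrak L$ is closed under $f^{-1}$ if $X\in\mathfrak L$ implies $f^{-1}(X)\in\mathfrak L$. *)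

theory Defs
  imports Main
begin

definition plus_congruence :: "int rel \<Rightarrow> bool" where
  "plus_congruence r \<longleftrightarrow>
     equiv UNIV r \<and>
     (\<forall>x y x' y'. (x, y) \<in> r \<longrightarrow> (x', y') \<in> r \<longrightarrow> (x + x', y + y') \<in> r)"

definition plus_congruence_preserving :: "(int \<Rightarrow> int) \<Rightarrow> bool" where
  "plus_congruence_preserving f \<longleftrightarrow>
     (\<forall>r. plus_congruence r \<longrightarrow> (\<forall>x y. (x, y) \<in> r \<longrightarrow> (f x, f y) \<in> r))"

definition surj_morphism_onto_finite ::
    "'m set \<Rightarrow> ('m \<Rightarrow> 'm \<Rightarrow> 'm) \<Rightarrow> (int \<Rightarrow> 'm) \<Rightarrow> bool" where
  "surj_morphism_onto_finite M opr \<phi> \<longleftrightarrow>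
     finite M \<and> (\<forall>a\<in>M. \<forall>b\<in>M. opr a b \<in> M) \<and>
     range \<phi> = M \<and> (\<forall>x y. \<phi> (x + y) = opr (\<phi> x) (\<phi> y))"

text \<open>
  HOL cannot quantify over types inside a definition, so the finite algebra has its carrier
  among the natural numbers. This loses no generality: see \<open>recognizableI\<close> below, where the
  carrier is a set over an arbitrary type.
\<close>

definition recognizable :: "int set \<Rightarrow> bool" where
  "recognizable L \<longleftrightarrow>
     (\<exists>(M :: nat set) opr \<phi>. surj_morphism_onto_finite M opr \<phi> \<and> L = \<phi> -` (\<phi> ` L))"

lemma recognizableI:
  fixes M :: "'m set"
  assumes "surj_morphism_onto_finite M opr \<phi>" and L: "L = \<phi> -` (\<phi> ` L)"
  shows "recognizable L"
proof -
  have fin: "finite M" and ran: "range \<phi> = M"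
    and cl: "\<And>a b. a \<in> M \<Longrightarrow> b \<in> M \<Longrightarrow> opr a b \<in> M"
    and hom: "\<And>x y. \<phi> (x + y) = opr (\<phi> x) (\<phi> y)"
    using assms(1) by (auto simp: surj_morphism_onto_finite_def)
  obtain e :: "'m \<Rightarrow> nat" where inj: "inj_on e M"
    using finite_imp_inj_to_nat_seg[OF fin] by blast
  define d where "d = inv_into M e"
  define opr' where "opr' a b = e (opr (d a) (d b))" for a b
  have de: "d (e m) = m" if "m \<in> M" for m
    using inj that by (simp add: d_def)
  have in_M: "\<phi> x \<in> M" for x
    using ran by auto
  have "surj_morphism_onto_finite (e ` M) opr' (e \<circ> \<phi>)"
    unfolding surj_morphism_onto_finite_def
  proof (intro conjI)
    show "finite (e ` M)" using fin by simp
    show "\<forall>a\<in>e ` M. \<forall>b\<in>e ` M. opr' a b \<in> e ` M"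
      by (auto simp: opr'_def de cl)
    show "range (e \<circ> \<phi>) = e ` M"
      by (simp only: image_comp[symmetric] ran)
    show "\<forall>x y. (e \<circ> \<phi>) (x + y) = opr' ((e \<circ> \<phi>) x) ((e \<circ> \<phi>) y)"
      by (simp add: opr'_def de in_M hom)
  qed
  moreover have "L = (e \<circ> \<phi>) -` ((e \<circ> \<phi>) ` L)"
  proof
    show "(e \<circ> \<phi>) -` ((e \<circ> \<phi>) ` L) \<subseteq> L"
    proof
      fix x assume "x \<in> (e \<circ> \<phi>) -` ((e \<circ> \<phi>) ` L)"
      then obtain y where y: "y \<in> L" "e (\<phi> x) = e (\<phi> y)" by auto
      then have "\<phi> x = \<phi> y" using inj in_M by (auto dest: inj_onD)
      then show "x \<in> L" using y(1) L by blast
    qed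
  qed auto
  ultimately show ?thesis
    unfolding recognizable_def by blast
qed

definition bounded_set_lattice :: "int set set \<Rightarrow> bool" where
  "bounded_set_lattice \<L> \<longleftrightarrow>
     UNIV \<in> \<L> \<and> {} \<in> \<L> \<and> (\<forall>X\<in>\<L>. \<forall>Y\<in>\<L>. X \<union> Y \<in> \<L> \<and> X \<inter> Y \<in> \<L>)"

definition translation_closed :: "int set set \<Rightarrow> bool" where
  "translation_closed \<L> \<longleftrightarrow> (\<forall>X\<in>\<L>. \<forall>a. {x. x + a \<in> X} \<in> \<L>)"

definition generated_lattice :: "int set \<Rightarrow> int set set" where
  "generated_lattice L =
     \<Inter>{\<L>. bounded_set_lattice \<L> \<and> translation_closed \<L> \<and> L \<in> \<L>}"

text \<open>The intersection is itself such a lattice, hence the smallest one.\<close>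

lemma generated_lattice_smallest:
  "bounded_set_lattice (generated_lattice L)"
  "translation_closed (generated_lattice L)"
  "L \<in> generated_lattice L"
  "\<lbrakk>bounded_set_lattice \<L>; translation_closed \<L>; L \<in> \<L>\<rbrakk> \<Longrightarrow> generated_lattice L \<subseteq> \<L>"
  by (auto simp: generated_lattice_def bounded_set_lattice_def translation_closed_def)

definition closed_under_preimage :: "(int \<Rightarrow> int) \<Rightarrow> int set set \<Rightarrow> bool" where
  "closed_under_preimage f \<L> \<longleftrightarrow> (\<forall>X\<in>\<L>. f -` X \<in> \<L>)"

end

theory Submission
  imports Defs
begin

text \<open>
  The proof rests on describing everything by translation periods. A set is recognizable exactly
  when it has a positive period (\<open>recognizable_iff_period\<close>): identifying two integers in a
  morphic image of \<open>\<int>\<close> identifies all pairs with the same difference.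

  For recognizable \<open>L\<close>, the generated lattice consists of exactly those sets that inherit all
  periods of \<open>L\<close> (\<open>generated_lattice_iff_periods\<close>). Indeed, \<open>L\<close> has only finitely many translates,
  so the lattice consists of the sets \<open>X\<close> that are upward closed for the preorder ``every
  translate of \<open>L\<close> containing \<open>y\<close> contains \<open>z\<close>''. This preorder says that \<open>L\<close> is mapped into itself
  by translation by \<open>z - y\<close>, and for a set with a positive period such a translation maps \<open>L\<close>
  onto itself (\<open>period_if_translate_subset\<close>). So the preorder is an equivalence, namely congruence
  modulo the group of periods of \<open>L\<close>.

  Now if \<open>f\<close> preserves congruences, then it preserves congruence modulo each period \<open>d\<close>, so
  \<open>f (x + d) - f x\<close> is a multiple of \<open>d\<close>, and the preimage of a set inheriting the periods of \<open>L\<close>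
  inherits them again. Conversely, if \<open>x \<noteq> y\<close> are congruent, then the class \<open>L\<close> of \<open>f x\<close> has the
  nonzero period \<open>y - x\<close>, so it is recognizable, and its preimage under \<open>f\<close> inherits this period;
  since the preimage contains \<open>x\<close>, it contains \<open>y\<close>.
\<close>

section \<open>Translation periods and recognizability\<close>

text \<open>Zero and negative periods are admitted, so that the periods of a set form a subgroup of \<open>\<int>\<close>.\<close>

definition period :: "int set \<Rightarrow> int \<Rightarrow> bool" where
  "period X d \<longleftrightarrow> (\<forall>x. x + d \<in> X \<longleftrightarrow> x \<in> X)"

lemma period_mult:
  assumes "period X d"
  shows "period X (d * m)"
proof (induction m rule: int_induct[where k = 0])
  case base
  show ?case by (simp add: period_def)
next
  case (step1 i)
  have "x + d * (i + 1) \<in> X \<longleftrightarrow> x \<in> X" for x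
  proof -
    have "x + d * (i + 1) = (x + d * i) + d" by (simp add: algebra_simps)
    then show ?thesis using assms step1.IH unfolding period_def by metis
  qed
  then show ?case by (simp add: period_def)
next
  case (step2 i)
  have "x + d * (i - 1) \<in> X \<longleftrightarrow> x \<in> X" for x
  proof -
    have "(x + d * (i - 1)) + d = x + d * i" by (simp add: algebra_simps)
    then show ?thesis using assms step2.IH unfolding period_def by metis
  qed
  then show ?case by (simp add: period_def)
qed

lemma period_cong:
  assumes "period X d" and "d dvd y - x"
  shows "y \<in> X \<longleftrightarrow> x \<in> X"
proof -
  obtain m where "y - x = d * m" using assms(2) by (rule dvdE)
  then have "y = x + d * m" by simp
  then show ?thesis using period_mult[OF assms(1), of m] by (simp add: period_def)
qed

text \<open>
  A morphism onto a finite algebra takes the same value at two different integers; adding an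
  arbitrary integer to both shows that their difference is a period of every saturated set.
  Conversely, a set of period \<open>k > 0\<close> is saturated for reduction modulo \<open>k\<close>.
\<close>

lemma recognizable_iff_period:
  "recognizable L \<longleftrightarrow> (\<exists>k>0. period L k)"
proof
  assume "recognizable L"
  then obtain M :: "nat set" and opr \<phi>
    where mor: "surj_morphism_onto_finite M opr \<phi>" and L: "L = \<phi> -` (\<phi> ` L)"
    unfolding recognizable_def by blast
  have hom: "\<phi> (x + y) = opr (\<phi> x) (\<phi> y)" for x y
    using mor by (simp add: surj_morphism_onto_finite_def)
  have "finite (range \<phi>)"
    using mor by (auto simp: surj_morphism_onto_finite_def)
  then have "\<not> inj \<phi>"
    using finite_imageD infinite_UNIV_int by blast
  then obtain i j where "\<phi> i = \<phi> j" "i < j"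
    by (metis injI linorder_neqE)
  have "\<phi> (x + (j - i)) = \<phi> x" for x
  proof -
    have "\<phi> (x + (j - i)) = \<phi> ((x - i) + j)" by (simp add: algebra_simps)
    also have "\<dots> = \<phi> ((x - i) + i)" using \<open>\<phi> i = \<phi> j\<close> by (simp only: hom)
    finally show ?thesis by simp
  qed
  then have "period L (j - i)"
    unfolding period_def by (metis L vimage_eq)
  then show "\<exists>k>0. period L k"
    using \<open>i < j\<close> by (intro exI[of _ "j - i"]) simp
next
  assume "\<exists>k>0. period L k"
  then obtain k where k: "k > 0" "period L k" by blast
  show "recognizable L"
  proof (rule recognizableI)
    have "range (\<lambda>x. x mod k) = {0..<k}"
    proof
      show "{0..<k} \<subseteq> range (\<lambda>x. x mod k)"
      proof
        fix x assume "x \<in> {0..<k}"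
        then have "x = x mod k" by simp
        then show "x \<in> range (\<lambda>x. x mod k)" by (rule range_eqI)
      qed
    qed (use k in auto)
    then show "surj_morphism_onto_finite {0..<k} (\<lambda>a b. (a + b) mod k) (\<lambda>x. x mod k)"
      using k by (simp add: surj_morphism_onto_finite_def mod_add_eq)
    have "x \<in> L" if "x mod k = y mod k" "y \<in> L" for x y
      using period_cong[OF k(2), of x y] that by (simp add: mod_eq_dvd_iff)
    then show "L = (\<lambda>x. x mod k) -` ((\<lambda>x. x mod k) ` L)"
      by auto
  qed
qed

text \<open>
  Translation by \<open>d\<close> can be undone inside \<open>L\<close>: modulo the positive period \<open>k\<close>, translation by \<open>- d\<close>
  is translation by \<open>(k - 1) * d\<close>, an iterate of translation by \<open>d\<close>.
\<close>

lemma period_if_translate_subset: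
  assumes k: "k > 0" "period L k"
    and sub: "\<And>x. x \<in> L \<Longrightarrow> x + d \<in> L"
  shows "period L d"
proof -
  have iter: "x + int n * d \<in> L" if "x \<in> L" for x n
  proof (induction n)
    case (Suc n)
    then have "(x + int n * d) + d \<in> L" by (rule sub)
    then show ?case by (simp add: algebra_simps)
  qed (simp add: that)
  have "x \<in> L" if "x + d \<in> L" for x
  proof -
    have "(x + d) + int (nat (k - 1)) * d \<in> L" using that by (rule iter)
    moreover have "(x + d) + int (nat (k - 1)) * d = x + k * d"
      using k(1) by (simp add: algebra_simps)
    ultimately have "x + k * d \<in> L" by (rule back_subst[of "\<lambda>u. u \<in> L"])
    then show ?thesis
      using period_mult[OF k(2), of d] by (simp add: period_def)
  qed
  then show ?thesis using sub by (auto simp: period_def)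
qed

section \<open>The generated lattice in terms of periods\<close>

text \<open>
  For a fixed \<open>d\<close>, the sets of period \<open>d\<close> form a translation-closed bounded lattice. If it contains
  \<open>L\<close>, it contains the lattice that \<open>L\<close> generates.
\<close>

lemma period_generated_lattice:
  assumes "X \<in> generated_lattice L" and "period L d"
  shows "period X d"
proof -
  have "bounded_set_lattice {X. period X d}"
    by (auto simp: bounded_set_lattice_def period_def)
  moreover have "period {x. x + a \<in> X} d" if "period X d" for X a
  proof -
    have "x + d + a \<in> X \<longleftrightarrow> x + a \<in> X" for x
      using that by (rule period_cong) simp
    then show ?thesis by (simp add: period_def)
  qed
  then have "translation_closed {X. period X d}"
    by (simp add: translation_closed_def)
  ultimately have "generated_lattice L \<subseteq> {X. period X d}"
    using assms(2) by (intro generated_lattice_smallest(4)) auto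
  then show ?thesis using assms(1) by auto
qed

lemma Inter_in_bounded_set_lattice:
  assumes "bounded_set_lattice \<L>" and "finite F" and "F \<subseteq> \<L>"
  shows "\<Inter>F \<in> \<L>"
  using assms(2,3,1)
  by (induction F rule: finite_induct) (auto simp: bounded_set_lattice_def)

lemma Union_in_bounded_set_lattice:
  assumes "bounded_set_lattice \<L>" and "finite F" and "F \<subseteq> \<L>"
  shows "\<Union>F \<in> \<L>"
  using assms(2,3,1)
  by (induction F rule: finite_induct) (auto simp: bounded_set_lattice_def)

text \<open>
  A set inheriting all periods of \<open>L\<close> is the union, over its elements \<open>y\<close>, of the intersection of
  all translates of \<open>L\<close> that contain \<open>y\<close>. As \<open>L\<close> has finitely many translates, this is a
  finite lattice expression.
\<close>

theorem generated_lattice_iff_periods: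
  assumes "recognizable L"
  shows "X \<in> generated_lattice L \<longleftrightarrow> (\<forall>d. period L d \<longrightarrow> period X d)"
proof
  assume "X \<in> generated_lattice L"
  then show "\<forall>d. period L d \<longrightarrow> period X d"
    using period_generated_lattice by blast
next
  assume inherits: "\<forall>d. period L d \<longrightarrow> period X d"
  obtain k where k: "k > 0" "period L k"
    using assms unfolding recognizable_iff_period by blast
  define T where "T = range (\<lambda>a. {x. x + a \<in> L})"
  define U where "U y = \<Inter>{t \<in> T. y \<in> t}" for y
  have lat: "bounded_set_lattice (generated_lattice L)"
    by (rule generated_lattice_smallest)
  have "{x. x + a \<in> L} = {x. x + a mod k \<in> L}" for a
  proof -
    have "x + a \<in> L \<longleftrightarrow> x + a mod k \<in> L" for x
      by (rule period_cong[OF k(2)]) (simp add: minus_mod_eq_mult_div)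
    then show ?thesis by simp
  qed
  then have "T \<subseteq> (\<lambda>a. {x. x + a \<in> L}) ` {0..<k}"
    unfolding T_def using k(1) by (fastforce intro: image_eqI[where x = "_ mod k"])
  then have finT: "finite T"
    by (rule finite_subset) simp
  have T_gen: "T \<subseteq> generated_lattice L"
    using generated_lattice_smallest(2,3)[of L] by (auto simp: T_def translation_closed_def)
  have U_gen: "U y \<in> generated_lattice L" for y
    unfolding U_def using T_gen finT by (intro Inter_in_bounded_set_lattice[OF lat]) auto
  have finU: "finite (U ` X)"
    by (rule finite_subset[of _ "Inter ` Pow T"]) (use finT in \<open>auto simp: U_def\<close>)
  have "U y \<subseteq> X" if "y \<in> X" for y
  proof
    fix z assume "z \<in> U y"
    then have above: "z + a \<in> L" if "y + a \<in> L" for a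
      using that by (auto simp: U_def T_def)
    have "period L (z - y)"
    proof (rule period_if_translate_subset[OF k])
      fix x assume "x \<in> L"
      then show "x + (z - y) \<in> L" using above[of "x - y"] by (simp add: algebra_simps)
    qed
    then have "period X (z - y)" using inherits by blast
    then show "z \<in> X" using period_cong[of X "z - y" z y] that by simp
  qed
  moreover have "y \<in> U y" for y
    by (simp add: U_def)
  ultimately have "X = \<Union>(U ` X)" by blast
  also have "\<dots> \<in> generated_lattice L"
    using U_gen finU by (intro Union_in_bounded_set_lattice[OF lat]) auto
  finally show "X \<in> generated_lattice L" .
qed

section \<open>Congruence preservation and preimages\<close>

lemma plus_congruence_dvd:
  "plus_congruence {(x, y). d dvd y - x}"
proof -
  have "equiv UNIV {(x, y). d dvd y - x}"
  proof (rule equivI)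
    show "sym {(x, y). d dvd y - x}"
      by (auto intro!: symI simp: dvd_diff_commute)
    show "trans {(x, y). d dvd y - x}"
    proof (rule transI)
      fix x y z assume "(x, y) \<in> {(x, y). d dvd y - x}" "(y, z) \<in> {(x, y). d dvd y - x}"
      then have "d dvd (z - y) + (y - x)" by (intro dvd_add) auto
      then show "(x, z) \<in> {(x, y). d dvd y - x}" by simp
    qed
  qed (auto intro: refl_onI)
  moreover have "d dvd (y + y') - (x + x')" if "d dvd y - x" "d dvd y' - x'" for x y x' y'
    using dvd_add[OF that] by (simp add: algebra_simps)
  ultimately show ?thesis
    unfolding plus_congruence_def by blast
qed

lemma plus_congruence_preserving_imp_dvd:
  assumes "plus_congruence_preserving f"
  shows "y - x dvd f y - f x"
  using assms plus_congruence_dvd[of "y - x"]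
  unfolding plus_congruence_preserving_def by auto

text \<open>
  Adding \<open>z - x\<close> to both sides of \<open>x \<sim> y\<close> gives \<open>z \<sim> z + (y - x)\<close> for every \<open>z\<close>, so each class is
  invariant under translation by \<open>y - x\<close>.
\<close>

lemma period_plus_congruence_class:
  assumes r: "plus_congruence r" and xy: "(x, y) \<in> r"
  shows "period (r `` {c}) (y - x)"
proof -
  have eqv: "equiv UNIV r"
    and add: "\<And>x y x' y'. (x, y) \<in> r \<Longrightarrow> (x', y') \<in> r \<Longrightarrow> (x + x', y + y') \<in> r"
    using r unfolding plus_congruence_def by blast+
  have refl: "(u, u) \<in> r" for u
    using eqv by (auto elim: equivE dest: refl_onD)
  have "(z, z + (y - x)) \<in> r" for z
    using add[OF xy refl, of "z - x"] by (simp add: algebra_simps)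
  then show ?thesis
    unfolding period_def Image_singleton_iff
    using equivE[OF eqv] by (metis symD transD)
qed

theorem theorem5p10:
  fixes f :: "int \<Rightarrow> int"
  shows "plus_congruence_preserving f \<longleftrightarrow>
    (\<forall>L. recognizable L \<longrightarrow> closed_under_preimage f (generated_lattice L))"
proof
  assume f: "plus_congruence_preserving f"
  show "\<forall>L. recognizable L \<longrightarrow> closed_under_preimage f (generated_lattice L)"
    unfolding closed_under_preimage_def
  proof (intro allI impI ballI)
    fix L X assume L: "recognizable L" and X: "X \<in> generated_lattice L"
    have "period (f -` X) d" if "period L d" for d
    proof -
      have "period X d" using X that by (rule period_generated_lattice)
      moreover have "d dvd f (x + d) - f x" for x
        using plus_congruence_preserving_imp_dvd[OF f, of "x + d" x] by simp
      ultimately have "f (x + d) \<in> X \<longleftrightarrow> f x \<in> X" for x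
        by (rule period_cong)
      then show ?thesis by (simp add: period_def)
    qed
    then show "f -` X \<in> generated_lattice L"
      using generated_lattice_iff_periods[OF L] by blast
  qed
next
  assume closed: "\<forall>L. recognizable L \<longrightarrow> closed_under_preimage f (generated_lattice L)"
  show "plus_congruence_preserving f"
    unfolding plus_congruence_preserving_def
  proof (intro allI impI)
    fix r x y assume r: "plus_congruence r" and xy: "(x, y) \<in> r"
    have refl: "(u, u) \<in> r" for u
      using r by (auto simp: plus_congruence_def elim: equivE dest: refl_onD)
    show "(f x, f y) \<in> r"
    proof (cases "x = y")
      case True
      then show ?thesis using refl by simp
    next
      case False
      define L where "L = r `` {f x}"
      have per: "period L (y - x)"
        unfolding L_def using r xy by (rule period_plus_congruence_class)
      \<comment> \<open>A period may be negative; multiplying by its sign gives a positive one.\<close>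
      have "period L \<bar>y - x\<bar>"
        using period_mult[OF per, of "sgn (y - x)"] by (simp add: abs_sgn)
      then have "recognizable L"
        using False unfolding recognizable_iff_period by (intro exI[of _ "\<bar>y - x\<bar>"]) simp
      then have "f -` L \<in> generated_lattice L"
        using closed generated_lattice_smallest(3) unfolding closed_under_preimage_def by blast
      then have "period (f -` L) (y - x)"
        using per by (rule period_generated_lattice)
      then have "y \<in> f -` L \<longleftrightarrow> x \<in> f -` L"
        by (rule period_cong) simp
      then show ?thesis using refl by (simp add: L_def)
    qed
  qed
qed

end
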